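(* A family of nontrivial graphical degree sequences is P-stable if and only if it is 2-stable.
   Context: A degree sequence is a sequence $\boldsymbol{d}=(d_1,\ldots,d_n)$ of nonnegative integers with even sum (the length $n$ may vary within a family); it is nontrivial if every component is positive. $\Omega(\boldsymbol{d})$ is the set of all simple graphs on vertex set $[n]=\{1,\ldots,n\}$ in which vertex $i$ has degree $d_i$ for all $i$; $\boldsymbol{d}$ is graphical if $\Omega(\boldsymbol{d})\neq\emptyset$. Let $\|\boldsymbol{x}\|_1=\sum_j|x_j|$ and $M(\boldsymbol{d})=\sum_j d_j$. $k$-stability: for a positive integer $k$ and real $\alpha\ge0$, a graphical $\boldsymbol{d}$ is $(k,\alpha)$-stable if $|\Omega(\boldsymbol{d}')|\le M(\boldsymbol{d})^{\alpha}|\Omega(\boldsymbol{d})|$ for every graphical degree sequence $\boldsymbol{d}'$ of length $n$ with $\|\boldsymbol{d}'-\boldsymbol{d}\|_1\le k$. A family is $k$-stable if there is a constant $\alpha>0$ such that all its members are $(k,\alpha)$-stable. P-stability: let $\Omega'(\boldsymbol{d})=\bigcup_{\boldsymbol{d}'}\Omega(\boldsymbol{d}')$, where $\boldsymbol{d}'$ ranges over all graphical degree sequences of length $n$ with $\|\boldsymbol{d}'-\boldsymbol{d}\|_1\le2$ and $d'_j\le d_j$ for all $j\in[n]$. A family $\mathcal{D}$ is P-stable if there is a polynomial $p$ such that $|\Omega'(\boldsymbol{d})|\le p(n)|\Omega(\boldsymbol{d})|$ for all positive integers $n$ and all $\boldsymbol{d}=(d_1,\ldots,d_n)\in\mathcal{D}$.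 *)

theory Defs
  imports Complex_Main "HOL-Computational_Algebra.Polynomial"
begin

text \<open>A sequence \<open>(d\<^sub>1, \<dots>, d\<^sub>n)\<close> is a list of length \<open>n\<close>; since lists are indexed
  from 0, \<open>d\<^sub>i\<close> is \<open>d ! (i - 1)\<close>. A sequence has at least one component.\<close>

definition degree_sequence :: "nat list \<Rightarrow> bool" where
  "degree_sequence d \<longleftrightarrow> d \<noteq> [] \<and> even (sum_list d)"

definition nontrivial :: "nat list \<Rightarrow> bool" where
  "nontrivial d \<longleftrightarrow> (\<forall>j < length d. d ! j > 0)"

text \<open>A simple graph on a given vertex set is identified with its set of edges,
  the edges being two-element sets of vertices.\<close>

definition simple_graph_on :: "'a set \<Rightarrow> 'a set set \<Rightarrow> bool" where
  "simple_graph_on V E \<longleftrightarrow> (\<forall>e \<in> E. e \<subseteq> V \<and> card e = 2)"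

definition vertex_degree :: "'a set set \<Rightarrow> 'a \<Rightarrow> nat" where
  "vertex_degree E v = card {e \<in> E. v \<in> e}"

definition realizations :: "nat list \<Rightarrow> nat set set set" (\<open>\<Omega>\<close>) where
  "\<Omega> d = {E. simple_graph_on {1..length d} E \<and>
             (\<forall>i \<in> {1..length d}. vertex_degree E i = d ! (i - 1))}"

lemma finite_realizations: "finite (\<Omega> d)"
proof (rule finite_subset)
  show "\<Omega> d \<subseteq> Pow (Pow {1..length d})"
    by (auto simp: realizations_def simple_graph_on_def)
qed simp

definition graphical :: "nat list \<Rightarrow> bool" where
  "graphical d \<longleftrightarrow> degree_sequence d \<and> \<Omega> d \<noteq> {}"

text \<open>\<open>\<parallel>x - y\<parallel>\<^sub>1\<close>, used only for sequences of equal length; the subtraction must not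
  be truncated.\<close>

definition l1_dist :: "nat list \<Rightarrow> nat list \<Rightarrow> int" where
  "l1_dist x y = (\<Sum>j < length y. \<bar>int (x ! j) - int (y ! j)\<bar>)"

text \<open>Here \<open>M(d)\<close> is \<open>sum_list d\<close>. The convention \<open>0 powr 0 = 0\<close> would only matter
  for \<open>M(d) = 0\<close>, which does not occur for nontrivial \<open>d\<close>.\<close>

definition stable :: "nat \<Rightarrow> real \<Rightarrow> nat list \<Rightarrow> bool" where
  "stable k \<alpha> d \<longleftrightarrow> graphical d \<and>
     (\<forall>d'. graphical d' \<and> length d' = length d \<and> l1_dist d' d \<le> int k \<longrightarrow>
        real (card (\<Omega> d')) \<le> real (sum_list d) powr \<alpha> * real (card (\<Omega> d)))"

definition stable_family :: "nat \<Rightarrow> nat list set \<Rightarrow> bool" where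
  "stable_family k D \<longleftrightarrow> (\<exists>\<alpha>>0. \<forall>d \<in> D. stable k \<alpha> d)"

definition lower_realizations :: "nat list \<Rightarrow> nat set set set" (\<open>\<Omega>''\<close>) where
  "\<Omega>' d = (\<Union>d' \<in> {d'. graphical d' \<and> length d' = length d \<and> l1_dist d' d \<le> 2 \<and>
                       (\<forall>j < length d. d' ! j \<le> d ! j)}. \<Omega> d')"

lemma finite_lower_realizations: "finite (\<Omega>' d)"
proof (rule finite_subset)
  show "\<Omega>' d \<subseteq> Pow (Pow {1..length d})"
    by (auto simp: lower_realizations_def realizations_def simple_graph_on_def)
qed simp

definition P_stable_family :: "nat list set \<Rightarrow> bool" where
  "P_stable_family D \<longleftrightarrow> (\<exists>p :: real poly. \<forall>n>0. \<forall>d \<in> D. length d = n \<longrightarrow>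
     real (card (\<Omega>' d)) \<le> poly p (real n) * real (card (\<Omega> d)))"

end

theory Submission
  imports Defs
begin

text \<open>
  For a nontrivial graphical sequence \<open>d\<close> of length \<open>n\<close> the numbers \<open>n\<close> and \<open>M(d)\<close> are
  polynomially related: every degree lies between \<open>1\<close> and \<open>n - 1\<close>, so \<open>n \<le> M(d) \<le> n\<^sup>2\<close>
  (lemma \<open>sum_list_graphical_bounds\<close>). Moreover \<open>M(d) \<ge> 2\<close>, so a power of \<open>M(d)\<close> also absorbs
  constant factors. Hence bounds by a polynomial in \<open>n\<close> and bounds by a power of \<open>M(d)\<close> are the
  same thing, uniformly over a family, and only \<open>\<Omega>' d\<close> and the sets \<open>\<Omega> d'\<close> for \<open>d'\<close> close
  to \<open>d\<close> have to be compared.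

  That 2-stability implies P-stability is a union bound: \<open>\<Omega>' d\<close> is a union of sets \<open>\<Omega> d'\<close>,
  and only polynomially many \<open>d'\<close> lie below \<open>d\<close> at distance at most \<open>2\<close>.

  For the converse, let \<open>d'\<close> be at distance at most \<open>2\<close> from \<open>d\<close>, not necessarily below it,
  and let \<open>E\<close> realize \<open>d'\<close>. As long as some vertex \<open>i\<close> has degree greater than \<open>d\<^sub>i\<close>, delete an
  edge \<open>ik\<close>. This brings the degree of \<open>i\<close> one step closer to \<open>d\<^sub>i\<close>, while the degree of \<open>k\<close>
  moves by one in some direction; so the distance to \<open>d\<close> does not grow, and the total
  excess over \<open>d\<close> falls. After at most two deletions the graph lies in \<open>\<Omega>' d\<close> (lemmas
  \<open>remove_excess_edges\<close> and \<open>realization_minus_few_edges\<close>). Since \<open>E\<close> can be recovered from the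
  resulting graph and the at most two deleted edges, \<open>|\<Omega> d'| \<le> n\<^sup>4 |\<Omega>' d|\<close>.
\<close>

section \<open>Degrees\<close>

lemma finite_simple_graph_on: "finite V \<Longrightarrow> simple_graph_on V E \<Longrightarrow> finite E"
  by (rule finite_subset[of _ "Pow V"]) (auto simp: simple_graph_on_def)

lemma simple_graph_on_subset: "simple_graph_on V E \<Longrightarrow> F \<subseteq> E \<Longrightarrow> simple_graph_on V F"
  by (auto simp: simple_graph_on_def)

lemma sum_vertex_degree:
  assumes "finite V" "simple_graph_on V E"
  shows "(\<Sum>v\<in>V. vertex_degree E v) = 2 * card E"
proof -
  have "(\<Sum>v\<in>V. card {e \<in> E. v \<in> e}) = 2 * card E"
  proof (rule sum_multicount)
    show "finite E" using assms by (rule finite_simple_graph_on)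
    have "{v \<in> V. v \<in> e} = e" if "e \<in> E" for e
      using assms that by (auto simp: simple_graph_on_def)
    then show "\<forall>e\<in>E. card {v \<in> V. v \<in> e} = 2"
      using assms by (auto simp: simple_graph_on_def)
  qed (use assms in simp)
  then show ?thesis by (simp add: vertex_degree_def)
qed

lemma vertex_degree_remove_edge:
  assumes "finite E" "e \<in> E"
  shows "vertex_degree E v = vertex_degree (E - {e}) v + (if v \<in> e then 1 else 0)"
proof (cases "v \<in> e")
  case True
  then have "{f \<in> E. v \<in> f} = insert e {f \<in> E - {e}. v \<in> f}" using assms by auto
  with True assms show ?thesis by (simp add: vertex_degree_def)
next
  case False
  then have "{f \<in> E. v \<in> f} = {f \<in> E - {e}. v \<in> f}" by auto
  with False show ?thesis by (simp add: vertex_degree_def)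
qed

lemma vertex_degree_less_card:
  assumes "finite V" "simple_graph_on V E" "v \<in> V"
  shows "vertex_degree E v < card V"
proof -
  have "{e \<in> E. v \<in> e} \<subseteq> (\<lambda>w. {v, w}) ` (V - {v})"
  proof
    fix e assume e: "e \<in> {e \<in> E. v \<in> e}"
    then have "card e = 2" "e \<subseteq> V" using assms by (auto simp: simple_graph_on_def)
    then obtain x y where "e = {x, y}" "x \<noteq> y" by (auto simp: card_2_iff)
    with e \<open>e \<subseteq> V\<close> show "e \<in> (\<lambda>w. {v, w}) ` (V - {v})" by auto
  qed
  then have "vertex_degree E v \<le> card ((\<lambda>w. {v, w}) ` (V - {v}))"
    unfolding vertex_degree_def using assms by (intro card_mono) auto
  also have "\<dots> \<le> card (V - {v})" using assms by (intro card_image_le) auto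
  also have "\<dots> < card V" using assms by (intro psubset_card_mono) auto
  finally show ?thesis .
qed

section \<open>Trading excess degree for deficient degree\<close>

text \<open>The three conclusions are proved together because one induction, deleting an edge at a
  vertex of excess degree in each step, gives all of them: each step lowers the total excess by
  at least one, which bounds the number of steps, and the gain at the vertex of excess degree
  pays for the possible loss at the other endpoint, which keeps the distance from growing.\<close>

lemma remove_excess_edges:
  fixes c :: "'a \<Rightarrow> nat"
  assumes "finite V" "simple_graph_on V E"
  shows "\<exists>F\<subseteq>E. card F \<le> (\<Sum>v\<in>V. vertex_degree E v - c v) \<and>
           (\<forall>v\<in>V. vertex_degree (E - F) v \<le> c v) \<and>
           (\<Sum>v\<in>V. \<bar>int (vertex_degree (E - F) v) - int (c v)\<bar>)
             \<le> (\<Sum>v\<in>V. \<bar>int (vertex_degree E v) - int (c v)\<bar>)"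
  using assms(2)
proof (induction "card E" arbitrary: E rule: less_induct)
  case less
  have fin: "finite E" using assms(1) less.prems by (rule finite_simple_graph_on)
  show ?case
  proof (cases "\<forall>v\<in>V. vertex_degree E v \<le> c v")
    case True
    then show ?thesis by (intro exI[of _ "{}"]) auto
  next
    case False
    then obtain i where i: "i \<in> V" "c i < vertex_degree E i" by (auto simp: not_le)
    then have "{e \<in> E. i \<in> e} \<noteq> {}" by (metis card.empty not_less_zero vertex_degree_def)
    then obtain e where e: "e \<in> E" "i \<in> e" by auto
    then have "card e = 2" "e \<subseteq> V" using less.prems by (auto simp: simple_graph_on_def)
    then obtain k where k: "e = {i, k}" "i \<noteq> k" "k \<in> V"
      using e(2) by (auto simp: card_2_iff)
    define E' where "E' = E - {e}"
    have deg: "vertex_degree E v = vertex_degree E' v + (if v \<in> e then 1 else 0)" for v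
      unfolding E'_def by (rule vertex_degree_remove_edge[OF fin e(1)])
    have "card E' < card E" using fin e(1) unfolding E'_def by (rule card_Diff1_less)
    moreover have "simple_graph_on V E'"
      using less.prems by (rule simple_graph_on_subset) (auto simp: E'_def)
    ultimately obtain F where F: "F \<subseteq> E'"
      "card F \<le> (\<Sum>v\<in>V. vertex_degree E' v - c v)"
      "\<forall>v\<in>V. vertex_degree (E' - F) v \<le> c v"
      "(\<Sum>v\<in>V. \<bar>int (vertex_degree (E' - F) v) - int (c v)\<bar>)
         \<le> (\<Sum>v\<in>V. \<bar>int (vertex_degree E' v) - int (c v)\<bar>)"
      using less.hyps by meson
    have split: "sum g V = g i + g k + sum g (V - {i, k})" for g :: "'a \<Rightarrow> 'b::comm_monoid_add"
    proof -
      have "sum g V = sum g {i, k} + sum g (V - {i, k})"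
        using assms(1) i k by (metis add.commute e(2) \<open>e \<subseteq> V\<close> sum.subset_diff)
      then show ?thesis using k by simp
    qed
    \<comment> \<open>At \<open>i\<close> the excess falls; at \<open>k\<close> it falls too, or stays at 0 if there was none.\<close>
    have "(\<Sum>v\<in>V. vertex_degree E' v - c v) < (\<Sum>v\<in>V. vertex_degree E v - c v)"
      by (rule sum_strict_mono_strong[OF assms(1) i(1)]) (use i deg e(2) in auto)
    moreover have "(\<Sum>v\<in>V. \<bar>int (vertex_degree E' v) - int (c v)\<bar>)
        \<le> (\<Sum>v\<in>V. \<bar>int (vertex_degree E v) - int (c v)\<bar>)"
    proof -
      have "(\<Sum>v\<in>V-{i,k}. \<bar>int (vertex_degree E' v) - int (c v)\<bar>)
         = (\<Sum>v\<in>V-{i,k}. \<bar>int (vertex_degree E v) - int (c v)\<bar>)"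
        using k(1) by (intro sum.cong) (auto simp: deg)
      moreover have "\<bar>int (vertex_degree E' i) - int (c i)\<bar> + 1 = \<bar>int (vertex_degree E i) - int (c i)\<bar>"
        using i(2) deg[of i] e(2) by simp
      moreover have "\<bar>int (vertex_degree E' k) - int (c k)\<bar> \<le> \<bar>int (vertex_degree E k) - int (c k)\<bar> + 1"
        using deg[of k] k(1) by simp
      ultimately show ?thesis by (simp add: split)
    qed
    moreover have "card (insert e F) \<le> Suc (card F)" by (rule card_insert_le_m1) auto
    moreover have "E - insert e F = E' - F" by (auto simp: E'_def)
    ultimately show ?thesis
      using F e(1) by (intro exI[of _ "insert e F"]) (auto simp: E'_def)
  qed
qed

section \<open>Degree sequences\<close>

definition degrees_of :: "nat \<Rightarrow> nat set set \<Rightarrow> nat list" where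
  "degrees_of n E = map (\<lambda>i. vertex_degree E (Suc i)) [0..<n]"

lemma length_degrees_of [simp]: "length (degrees_of n E) = n"
  by (simp add: degrees_of_def)

lemma nth_degrees_of [simp]: "j < n \<Longrightarrow> degrees_of n E ! j = vertex_degree E (Suc j)"
  by (simp add: degrees_of_def)

lemma realizations_iff:
  "E \<in> \<Omega> d \<longleftrightarrow> simple_graph_on {1..length d} E \<and> d = degrees_of (length d) E"
proof -
  have "(\<forall>i\<in>{1..length d}. vertex_degree E i = d ! (i - 1)) \<longleftrightarrow>
        (\<forall>j<length d. d ! j = vertex_degree E (Suc j))"
    by (force simp: Ball_def Suc_le_eq gr0_conv_Suc)
  also have "\<dots> \<longleftrightarrow> d = degrees_of (length d) E"
    by (auto simp: list_eq_iff_nth_eq)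
  finally show ?thesis by (auto simp: realizations_def)
qed

lemma sum_list_degrees_of: "sum_list (degrees_of n E) = (\<Sum>v\<in>{1..n}. vertex_degree E v)"
  by (simp add: sum_list_sum_nth atLeast0LessThan sum.atLeast1_atMost_eq)

lemma l1_dist_degrees_of:
  "l1_dist (degrees_of (length d) E) d =
     (\<Sum>v\<in>{1..length d}. \<bar>int (vertex_degree E v) - int (d ! (v - 1))\<bar>)"
  unfolding l1_dist_def One_nat_def sum.atLeast1_atMost_eq by simp

lemma graphical_degrees_of:
  assumes "simple_graph_on {1..n} E" "n > 0"
  shows "graphical (degrees_of n E)"
proof -
  have "E \<in> \<Omega> (degrees_of n E)" using assms by (simp add: realizations_iff)
  moreover have "even (sum_list (degrees_of n E))"
    using assms by (simp add: sum_list_degrees_of sum_vertex_degree del: One_nat_def)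
  moreover have "degrees_of n E \<noteq> []" using assms(2) by (simp add: degrees_of_def)
  ultimately show ?thesis unfolding graphical_def degree_sequence_def by blast
qed

text \<open>The total excess of \<open>d'\<close> over \<open>d\<close> is at most their distance, hence at most 2. That the
  degrees left after the deletions again have even sum is the handshake lemma.\<close>

lemma realization_minus_few_edges:
  assumes "graphical d'" "length d' = length d" "l1_dist d' d \<le> 2" "E \<in> \<Omega> d'"
  obtains F where "F \<subseteq> E" "card F \<le> 2" "E - F \<in> \<Omega>' d"
proof -
  let ?n = "length d"
  let ?V = "{1..?n}"
  let ?c = "\<lambda>v. d ! (v - 1)"
  have E: "simple_graph_on ?V E" and d': "d' = degrees_of ?n E"
    using assms by (auto simp: realizations_iff)
  obtain F where F: "F \<subseteq> E" "card F \<le> (\<Sum>v\<in>?V. vertex_degree E v - ?c v)"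
    "\<forall>v\<in>?V. vertex_degree (E - F) v \<le> ?c v"
    "(\<Sum>v\<in>?V. \<bar>int (vertex_degree (E - F) v) - int (?c v)\<bar>)
       \<le> (\<Sum>v\<in>?V. \<bar>int (vertex_degree E v) - int (?c v)\<bar>)"
    using remove_excess_edges[OF _ E, of ?c] by auto
  have l1: "(\<Sum>v\<in>?V. \<bar>int (vertex_degree E v) - int (?c v)\<bar>) \<le> 2"
    using assms(3) unfolding d' l1_dist_degrees_of .
  have "int (\<Sum>v\<in>?V. vertex_degree E v - ?c v) \<le> (\<Sum>v\<in>?V. \<bar>int (vertex_degree E v) - int (?c v)\<bar>)"
    unfolding of_nat_sum by (intro sum_mono) auto
  with F(2) l1 have "card F \<le> 2" by linarith
  moreover have "E - F \<in> \<Omega>' d"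
  proof -
    let ?d = "degrees_of ?n (E - F)"
    have G: "simple_graph_on ?V (E - F)" using E by (rule simple_graph_on_subset) auto
    have "?n > 0" using assms by (auto simp: graphical_def degree_sequence_def)
    then have "graphical ?d" using G by (intro graphical_degrees_of)
    moreover have "l1_dist ?d d \<le> 2" using F(4) l1 unfolding l1_dist_degrees_of by linarith
    moreover have "\<forall>j<?n. ?d ! j \<le> d ! j" using F(3) by (auto simp: Ball_def Suc_le_eq)
    moreover have "E - F \<in> \<Omega> ?d" using G by (simp add: realizations_iff)
    ultimately show ?thesis unfolding lower_realizations_def by auto
  qed
  ultimately show ?thesis using that F(1) by blast
qed

section \<open>Counting\<close>

lemma finite_card_subset_image:
  assumes "finite A" "B \<subseteq> f ` A"
  shows "finite B" "card B \<le> card A"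
  using assms by (auto intro: finite_subset surj_card_le)

text \<open>A set of at most \<open>k\<close> elements is built in \<open>k\<close> steps, each of which adds one of the elements of
  \<open>S\<close> or, encoded by \<^const>\<open>None\<close>, adds nothing.\<close>

lemma card_small_subsets_le:
  assumes "finite S"
  shows "finite {F. F \<subseteq> S \<and> card F \<le> k} \<and> card {F. F \<subseteq> S \<and> card F \<le> k} \<le> (card S + 1) ^ k"
proof (induction k)
  case 0
  have "{F. F \<subseteq> S \<and> card F \<le> 0} = {{}}" using assms by (auto dest: finite_subset)
  then show ?case by simp
next
  case (Suc k)
  let ?A = "insert None (Some ` S)" and ?B = "{F. F \<subseteq> S \<and> card F \<le> k}"
  let ?f = "\<lambda>(x, F). F \<union> set_option x"
  have "{F. F \<subseteq> S \<and> card F \<le> Suc k} \<subseteq> ?f ` (?A \<times> ?B)"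
  proof
    fix F assume F: "F \<in> {F. F \<subseteq> S \<and> card F \<le> Suc k}"
    show "F \<in> ?f ` (?A \<times> ?B)"
    proof (cases "F = {}")
      case True
      then show ?thesis by (intro image_eqI[of _ _ "(None, F)"]) auto
    next
      case False
      then obtain x where x: "x \<in> F" by auto
      have "finite F" using F assms by (auto dest: finite_subset)
      then show ?thesis using F x by (intro image_eqI[of _ _ "(Some x, F - {x})"]) auto
    qed
  qed
  moreover have "finite (?A \<times> ?B)" using assms Suc by auto
  moreover have "card (?A \<times> ?B) \<le> (card S + 1) ^ Suc k"
  proof -
    have "card ?A = card S + 1" using assms by (simp add: card_image image_iff)
    then show ?thesis using Suc by (simp only: card_cartesian_product power_Suc mult_le_mono2)
  qed
  ultimately show ?case using finite_card_subset_image by (meson order_trans)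
qed

text \<open>Likewise \<open>d'\<close> is reached from \<open>d\<close> in \<open>k\<close> steps, each of which lowers one component or none.
  The idle step is a list update at position \<open>length d\<close>, which is out of range and therefore
  leaves the list as it is.\<close>

lemma card_sequences_below_le:
  fixes d :: "nat list"
  defines "L \<equiv> \<lambda>k. {d'. length d' = length d \<and> (\<forall>j<length d. d' ! j \<le> d ! j) \<and>
                        (\<Sum>j<length d. d ! j - d' ! j) \<le> k}"
  shows "finite (L k) \<and> card (L k) \<le> (length d + 1) ^ k"
proof (induction k)
  case 0
  have "L 0 = {d}" by (auto simp: L_def list_eq_iff_nth_eq intro!: le_antisym)
  then show ?case by simp
next
  case (Suc k)
  let ?f = "\<lambda>(i, d'). d'[i := d' ! i - 1]"
  have "L (Suc k) \<subseteq> ?f ` ({..length d} \<times> L k)"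
  proof
    fix d' assume d': "d' \<in> L (Suc k)"
    show "d' \<in> ?f ` ({..length d} \<times> L k)"
    proof (cases "\<exists>i<length d. d' ! i < d ! i")
      case False
      then have "(\<Sum>j<length d. d ! j - d' ! j) = 0" by (intro sum.neutral) auto
      with d' have "d' \<in> L k" by (auto simp: L_def)
      with d' show ?thesis by (intro image_eqI[of _ _ "(length d, d')"]) (auto simp: L_def list_update_beyond)
    next
      case True
      then obtain i where i: "i < length d" "d' ! i < d ! i" by auto
      let ?d = "d'[i := Suc (d' ! i)]"
      have len: "length d' = length d" using d' by (simp add: L_def)
      have "(\<Sum>j<length d. d ! j - ?d ! j) < (\<Sum>j<length d. d ! j - d' ! j)"
        by (rule sum_strict_mono_strong[of _ i]) (use i len in \<open>auto simp: nth_list_update\<close>)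
      then have "?d \<in> L k" using d' i by (auto simp: L_def nth_list_update)
      then show ?thesis using i len by (intro image_eqI[of _ _ "(i, ?d)"]) auto
    qed
  qed
  moreover have "finite ({..length d} \<times> L k)" using Suc by auto
  moreover have "card ({..length d} \<times> L k) \<le> (length d + 1) ^ Suc k"
  proof -
    have "card {..length d} = length d + 1" by simp
    then show ?thesis using Suc by (simp only: card_cartesian_product power_Suc mult_le_mono2)
  qed
  ultimately show ?case using finite_card_subset_image by (meson order_trans)
qed

text \<open>The map that adds a set of at most two edges to a graph sends the pairs of such a set and a
  member of \<open>\<Omega>' d\<close> onto a superset of \<open>\<Omega> d'\<close>.\<close>

lemma card_realizations_le_lower:
  assumes "graphical d'" "length d' = length d" "l1_dist d' d \<le> 2"
  shows "card (\<Omega> d') \<le> length d ^ 4 * card (\<Omega>' d)"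
proof -
  let ?n = "length d"
  let ?K = "{e. e \<subseteq> {1..?n} \<and> card e = 2}"
  let ?S = "{F. F \<subseteq> ?K \<and> card F \<le> 2}"
  have n: "?n > 0" using assms by (auto simp: graphical_def degree_sequence_def)
  have K: "finite ?K" "card ?K = ?n choose 2"
    by (auto simp: n_subsets)
  have S: "finite ?S" "card ?S \<le> ((?n choose 2) + 1) ^ 2"
    using card_small_subsets_le[OF K(1), of 2] unfolding K(2) by auto
  have "(?n choose 2) + 1 \<le> ?n ^ 2"
  proof -
    have "?n choose 2 \<le> ?n * (?n - 1)" by (simp add: choose_two)
    then show ?thesis using n by (cases ?n) (auto simp: power2_eq_square)
  qed
  then have "((?n choose 2) + 1) ^ 2 \<le> (?n ^ 2) ^ 2" by (rule power_mono) simp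
  with S have S4: "card ?S \<le> ?n ^ 4" by simp
  have "\<Omega> d' \<subseteq> (\<lambda>(F, H). H \<union> F) ` (?S \<times> \<Omega>' d)"
  proof
    fix E assume E: "E \<in> \<Omega> d'"
    then obtain F where F: "F \<subseteq> E" "card F \<le> 2" "E - F \<in> \<Omega>' d"
      using realization_minus_few_edges assms by blast
    moreover have "E \<subseteq> ?K" using E assms(2) by (auto simp: realizations_def simple_graph_on_def)
    ultimately show "E \<in> (\<lambda>(F, H). H \<union> F) ` (?S \<times> \<Omega>' d)"
      by (intro image_eqI[of _ _ "(F, E - F)"]) auto
  qed
  then have "card (\<Omega> d') \<le> card (?S \<times> \<Omega>' d)"
    using S(1) by (intro finite_card_subset_image(2)) (auto simp: finite_lower_realizations)
  also have "\<dots> \<le> ?n ^ 4 * card (\<Omega>' d)" using S4 by (simp add: card_cartesian_product)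
  finally show ?thesis .
qed

lemma card_lower_realizations_le:
  fixes B :: real
  assumes "\<And>d'. graphical d' \<Longrightarrow> length d' = length d \<Longrightarrow> l1_dist d' d \<le> 2 \<Longrightarrow>
             real (card (\<Omega> d')) \<le> B"
    and "B \<ge> 0"
  shows "real (card (\<Omega>' d)) \<le> (real (length d) + 1) ^ 2 * B"
proof -
  let ?L = "{d'. graphical d' \<and> length d' = length d \<and> l1_dist d' d \<le> 2 \<and>
                       (\<forall>j < length d. d' ! j \<le> d ! j)}"
  let ?L' = "{d'. length d' = length d \<and> (\<forall>j<length d. d' ! j \<le> d ! j) \<and>
                        (\<Sum>j<length d. d ! j - d' ! j) \<le> 2}"
  have "(\<Sum>j<length d. d ! j - d' ! j) \<le> 2" if "d' \<in> ?L" for d'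
  proof -
    have "int (\<Sum>j<length d. d ! j - d' ! j) = l1_dist d' d"
      unfolding l1_dist_def of_nat_sum using that by (intro sum.cong) auto
    moreover have "l1_dist d' d \<le> 2" using that by simp
    ultimately show ?thesis by linarith
  qed
  then have sub: "?L \<subseteq> ?L'" by auto
  have L': "finite ?L'" "card ?L' \<le> (length d + 1) ^ 2"
    using card_sequences_below_le[of d 2] by auto
  have L: "finite ?L" "card ?L \<le> (length d + 1) ^ 2"
    using finite_subset[OF sub L'(1)] card_mono[OF L'(1) sub] L'(2) by auto
  have "card (\<Omega>' d) \<le> (\<Sum>d'\<in>?L. card (\<Omega> d'))"
    unfolding lower_realizations_def using L(1) by (rule card_UN_le)
  then have "real (card (\<Omega>' d)) \<le> real (\<Sum>d'\<in>?L. card (\<Omega> d'))"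
    by (simp only: of_nat_le_iff)
  also have "\<dots> = (\<Sum>d'\<in>?L. real (card (\<Omega> d')))" by (rule of_nat_sum)
  also have "\<dots> \<le> real (card ?L) * B" using assms(1) by (intro sum_bounded_above) auto
  also have "\<dots> \<le> real ((length d + 1) ^ 2) * B"
    using L(2) assms(2) by (intro mult_right_mono) (simp_all only: of_nat_le_iff)
  finally show ?thesis by (simp add: add.commute)
qed

section \<open>The equivalence\<close>

lemma sum_list_graphical_bounds:
  assumes "graphical d" "nontrivial d"
  shows "2 \<le> sum_list d" "length d \<le> sum_list d" "sum_list d \<le> length d ^ 2"
proof -
  let ?n = "length d"
  obtain E where "E \<in> \<Omega> d" using assms by (auto simp: graphical_def)
  then have E: "simple_graph_on {1..?n} E" and d: "\<forall>j<?n. d ! j = vertex_degree E (Suc j)"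
    by (simp_all add: realizations_def)
  have less: "d ! j < ?n" if "j < ?n" for j
    using vertex_degree_less_card[OF _ E, of "Suc j"] d that by simp
  have sum: "sum_list d = (\<Sum>j<?n. d ! j)" by (simp add: sum_list_sum_nth atLeast0LessThan)
  show "sum_list d \<le> ?n ^ 2"
    using sum_mono[of "{..<?n}" "\<lambda>j. d ! j" "\<lambda>_. ?n"] less
    by (simp add: sum power2_eq_square less_imp_le)
  show le: "?n \<le> sum_list d"
    using sum_mono[of "{..<?n}" "\<lambda>_. 1" "\<lambda>j. d ! j"] assms(2)
    by (simp add: sum nontrivial_def Suc_le_eq)
  have "?n > 0" "even (sum_list d)" using assms by (auto simp: graphical_def degree_sequence_def)
  with le show "2 \<le> sum_list d" by presburger
qed

text \<open>With \<open>C\<close> the sum of the absolute values of the coefficients, the polynomial is at most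
  \<open>C * n ^ degree p\<close>, and the constant \<open>C\<close> is absorbed into a power of \<open>M\<close> because \<open>M \<ge> 2\<close>.\<close>

lemma poly_le_power:
  fixes p :: "real poly"
  shows "\<exists>k. \<forall>n M :: nat. 1 \<le> n \<longrightarrow> n \<le> M \<longrightarrow> 2 \<le> M \<longrightarrow> poly p (real n) \<le> real M ^ k"
proof -
  define C where "C = (\<Sum>i\<le>degree p. \<bar>coeff p i\<bar>)"
  obtain c where c: "C < 2 ^ c" using real_arch_pow[of 2 C] by auto
  have "poly p (real n) \<le> real M ^ (c + degree p)" if "1 \<le> n" "n \<le> M" "2 \<le> M" for n M :: nat
  proof -
    have "poly p (real n) = (\<Sum>i\<le>degree p. coeff p i * real n ^ i)" by (rule poly_altdef)
    also have "\<dots> \<le> (\<Sum>i\<le>degree p. \<bar>coeff p i\<bar> * real n ^ degree p)"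
      using that by (intro sum_mono mult_mono power_increasing) auto
    also have "\<dots> = C * real n ^ degree p" by (simp add: C_def sum_distrib_right)
    also have "\<dots> \<le> real M ^ c * real M ^ degree p"
    proof (intro mult_mono power_mono)
      have "(2::real) ^ c \<le> real M ^ c" using that by (intro power_mono) auto
      with c show "C \<le> real M ^ c" by linarith
    qed (use that in auto)
    finally show ?thesis by (simp add: power_add)
  qed
  then show ?thesis by blast
qed

lemma P_stable_imp_2_stable:
  assumes D: "\<And>d. d \<in> D \<Longrightarrow> graphical d \<and> nontrivial d" and "P_stable_family D"
  shows "stable_family 2 D"
proof -
  obtain p :: "real poly" where p: "\<And>d. d \<in> D \<Longrightarrow> length d > 0 \<Longrightarrow>
      real (card (\<Omega>' d)) \<le> poly p (real (length d)) * real (card (\<Omega> d))"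
    using assms(2) by (auto simp: P_stable_family_def)
  obtain k where k: "\<And>n M :: nat. 1 \<le> n \<Longrightarrow> n \<le> M \<Longrightarrow> 2 \<le> M \<Longrightarrow> poly p (real n) \<le> real M ^ k"
    using poly_le_power[of p] by blast
  \<comment> \<open>The exponent is 4 for the deleted edges and \<open>k\<close> for the polynomial.\<close>
  have "stable 2 (real (4 + k)) d" if d: "d \<in> D" for d
    unfolding stable_def
  proof (intro conjI allI impI)
    show gr: "graphical d" using D d by blast
    fix d' assume d': "graphical d' \<and> length d' = length d \<and> l1_dist d' d \<le> int 2"
    let ?M = "sum_list d"
    note M = sum_list_graphical_bounds[OF gr conjunct2[OF D[OF d]]]
    have n: "length d > 0" using gr by (auto simp: graphical_def degree_sequence_def)
    have "card (\<Omega> d') \<le> length d ^ 4 * card (\<Omega>' d)"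
      using d' by (intro card_realizations_le_lower) auto
    then have "real (card (\<Omega> d')) \<le> real (length d) ^ 4 * real (card (\<Omega>' d))"
      by (metis of_nat_le_iff of_nat_mult of_nat_power)
    also have "\<dots> \<le> real ?M ^ 4 * (real ?M ^ k * real (card (\<Omega> d)))"
    proof (intro mult_mono power_mono)
      have "poly p (real (length d)) \<le> real ?M ^ k" using n M by (intro k) (simp_all add: Suc_le_eq)
      then show "real (card (\<Omega>' d)) \<le> real ?M ^ k * real (card (\<Omega> d))"
        using p[OF d n] by (meson mult_right_mono of_nat_0_le_iff order_trans)
    qed (use M in auto)
    also have "\<dots> = real ?M powr real (4 + k) * real (card (\<Omega> d))"
      using M by (subst powr_realpow) (auto simp: power_add)
    finally show "real (card (\<Omega> d')) \<le> real ?M powr real (4 + k) * real (card (\<Omega> d))" .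
  qed
  then show ?thesis unfolding stable_family_def by (intro exI[of _ "real (4 + k)"]) auto
qed

lemma stable_2_imp_P_stable:
  assumes D: "\<And>d. d \<in> D \<Longrightarrow> graphical d \<and> nontrivial d" and "stable_family 2 D"
  shows "P_stable_family D"
proof -
  obtain \<alpha> where \<alpha>: "\<alpha> > 0" "\<And>d. d \<in> D \<Longrightarrow> stable 2 \<alpha> d"
    using assms(2) by (auto simp: stable_family_def)
  define k where "k = nat \<lceil>\<alpha>\<rceil>"
  \<comment> \<open>The factor \<open>(n + 1)\<^sup>2\<close> counts the sequences below \<open>d\<close>; the factor \<open>n ^ (2 * k)\<close> bounds
    \<open>M(d) powr \<alpha>\<close>, as \<open>M(d) \<le> n\<^sup>2\<close>.\<close>
  define p :: "real poly" where "p = [:1, 1:] ^ 2 * monom 1 (2 * k)"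
  have "real (card (\<Omega>' d)) \<le> poly p (real (length d)) * real (card (\<Omega> d))" if d: "d \<in> D" for d
  proof -
    let ?M = "sum_list d" and ?n = "length d"
    have gr: "graphical d" using D d by blast
    note M = sum_list_graphical_bounds[OF gr conjunct2[OF D[OF d]]]
    have "real ?M powr \<alpha> \<le> real ?M powr real k"
      using M \<alpha>(1) unfolding k_def by (intro powr_mono) (auto simp: le_nat_iff)
    also have "\<dots> = real ?M ^ k" using M by (subst powr_realpow) auto
    also have "\<dots> \<le> real (?n ^ 2) ^ k"
      using M(3) by (intro power_mono) (simp_all only: of_nat_le_iff of_nat_0_le_iff)
    also have "\<dots> = real ?n ^ (2 * k)" by (simp add: power_mult)
    finally have pow: "real ?M powr \<alpha> \<le> real ?n ^ (2 * k)" .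
    have "real (card (\<Omega>' d)) \<le> (real ?n + 1) ^ 2 * (real ?M powr \<alpha> * real (card (\<Omega> d)))"
      using \<alpha>(2)[OF d] by (intro card_lower_realizations_le) (auto simp: stable_def)
    also have "\<dots> \<le> (real ?n + 1) ^ 2 * (real ?n ^ (2 * k) * real (card (\<Omega> d)))"
      using pow by (intro mult_left_mono mult_right_mono) auto
    also have "\<dots> = poly p (real ?n) * real (card (\<Omega> d))"
      by (simp add: p_def poly_monom add.commute)
    finally show ?thesis .
  qed
  then show ?thesis unfolding P_stable_family_def by blast
qed

theorem proposition6p2:
  fixes D :: "nat list set"
  assumes "\<And>d. d \<in> D \<Longrightarrow> graphical d \<and> nontrivial d"
  shows "P_stable_family D \<longleftrightarrow> stable_family 2 D"
  using P_stable_imp_2_stable[of D] stable_2_imp_P_stable[of D] assms by blast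

end
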